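(* Every poset that is moderately meet continuous and quasiexact is exact and meet continuous.
   Context: Let $P$ be a poset. For $A\subseteq P$, $\uparrow A=\{x\in P: y\le x \text{ for some } y\in A\}$ and $\downarrow A=\{x\in P: x\le y\text{ for some }y\in A\}$; write $\uparrow x,\downarrow x$ for $A=\{x\}$. Directed sets are nonempty. Weak way-below: for $x,y\in P$, $x\ll_w y$ iff for every directed $D\subseteq P$ with $\bigvee D=y$ (supremum exists and equals $y$), $D\cap\uparrow x\ne\varnothing$. For $G\subseteq P$ and $y\in P$, $G\ll_w y$ iff for every directed $D\subseteq P$ with $\bigvee D=y$, $D\cap\uparrow G\neq\varnothing$. $P$ is exact if for every $x\in P$ the set $\{y\in P: y\ll_w x\}$ is directed and has supremum $x$. $\mathrm{fin}_w(x)=\{F\subseteq P: F\text{ finite}, F\ll_w x\}$. A nonempty family $\mathcal F$ of subsets of $P$ is directed if for all $F_1,F_2\in\mathcal F$ there is $F_3\in\mathcal F$ with $F_3\subseteq\uparrow F_1\cap\uparrow F_2$. $P$ is quasiexact if for every $x\in P$ the family $\mathrm{fin}_w(x)$ is directed and $\bigcap\{\uparrow F: F\in\mathrm{fin}_w(x)\}=\uparrow x$. For $F\subseteq P$ put $U_F=\{a\in P: F\ll_w a\}$. $P$ admits the wf topology if $\{U_F: F\subseteq P\text{ finite}\}$ is a base of a topology on $P$; this topology is denoted $\tau_{wf}(P)$ (every quasiexact poset admits it). A poset $P$ admitting the wf topology is moderately meet continuous if for every $x\in P$ and every directed $D\subseteq P$ (with existing supremum), $x\le\bigvee D$ implies $x\in\mathrm{cl}_{\tau_{wf}}(\downarrow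 D\cap\downarrow x)$, the closure taken in $\tau_{wf}(P)$. A set $U\subseteq P$ is Scott open if $U=\uparrow U$ and, for every directed $D$ whose supremum exists, $\bigvee D\in U$ implies $D\cap U\ne\varnothing$; the Scott open sets form the Scott topology $\sigma(P)$. $P$ is meet continuous if for every $x\in P$ and every directed $D\subseteq P$ (with existing supremum), $x\le\bigvee D$ implies $x\in\mathrm{cl}_{\sigma}(\downarrow D\cap\downarrow x)$, the closure taken in $\sigma(P)$. *)

theory Defs
  imports "HOL-Analysis.Abstract_Topology" "HOL-Library.Lub_Glb"
begin

text \<open>A poset is a type of class \<^class>\<open>order\<close>. The principal sets generated by \<open>x\<close> are
  \<open>{x..}\<close> and \<open>{..x}\<close>, and \<open>isLub UNIV D s\<close> says that the supremum of \<open>D\<close> exists and equals \<open>s\<close>.\<close>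

definition up :: "'a::order set \<Rightarrow> 'a set" where
  "up A = {x. \<exists>y\<in>A. y \<le> x}"

definition down :: "'a::order set \<Rightarrow> 'a set" where
  "down A = {x. \<exists>y\<in>A. x \<le> y}"

definition directed :: "'a::order set \<Rightarrow> bool" where
  "directed D \<longleftrightarrow> D \<noteq> {} \<and> (\<forall>a\<in>D. \<forall>b\<in>D. \<exists>c\<in>D. a \<le> c \<and> b \<le> c)"

definition weak_way_below :: "'a::order \<Rightarrow> 'a \<Rightarrow> bool"  (infix \<open>\<lless>\<^sub>w\<close> 50) where
  "x \<lless>\<^sub>w y \<longleftrightarrow> (\<forall>D. directed D \<and> isLub UNIV D y \<longrightarrow> D \<inter> {x..} \<noteq> {})"

definition set_weak_way_below :: "'a::order set \<Rightarrow> 'a \<Rightarrow> bool"  (infix \<open>\<lless>\<^sub>W\<close> 50) where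
  "G \<lless>\<^sub>W y \<longleftrightarrow> (\<forall>D. directed D \<and> isLub UNIV D y \<longrightarrow> D \<inter> up G \<noteq> {})"

text \<open>The type argument in the following class-wide properties is the poset itself.\<close>

definition exact_poset :: "'a::order itself \<Rightarrow> bool" where
  "exact_poset _ \<longleftrightarrow>
    (\<forall>x::'a. directed {y. y \<lless>\<^sub>w x} \<and> isLub UNIV {y. y \<lless>\<^sub>w x} x)"

definition fin_w :: "'a::order \<Rightarrow> 'a set set" where
  "fin_w x = {F. finite F \<and> F \<lless>\<^sub>W x}"

definition directed_family :: "'a::order set set \<Rightarrow> bool" where
  "directed_family \<F> \<longleftrightarrow>
    \<F> \<noteq> {} \<and> (\<forall>F\<^sub>1\<in>\<F>. \<forall>F\<^sub>2\<in>\<F>. \<exists>F\<^sub>3\<in>\<F>. F\<^sub>3 \<subseteq> up F\<^sub>1 \<inter> up F\<^sub>2)"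

definition quasiexact_poset :: "'a::order itself \<Rightarrow> bool" where
  "quasiexact_poset _ \<longleftrightarrow>
    (\<forall>x::'a. directed_family (fin_w x) \<and> (\<Inter>F\<in>fin_w x. up F) = {x..})"

definition wf_basic :: "'a::order set \<Rightarrow> 'a set" where
  "wf_basic F = {a. F \<lless>\<^sub>W a}"

definition wf_base :: "'a::order set \<Rightarrow> bool" where
  "wf_base U \<longleftrightarrow> (\<exists>F. finite F \<and> U = wf_basic F)"

definition admits_wf_topology :: "'a::order itself \<Rightarrow> bool" where
  "admits_wf_topology _ \<longleftrightarrow>
    (\<exists>T::'a topology. topspace T = UNIV \<and> openin T = arbitrary union_of wf_base)"

text \<open>Meaningful only for posets admitting the wf topology.\<close>

definition wf_topology :: "'a::order topology" where
  "wf_topology = topology (arbitrary union_of wf_base)"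

lemma
  assumes "admits_wf_topology TYPE('a::order)"
  shows openin_wf_topology: "openin (wf_topology :: 'a topology) = arbitrary union_of wf_base"
    and topspace_wf_topology: "topspace (wf_topology :: 'a topology) = UNIV"
proof -
  obtain T :: "'a topology"
    where T: "topspace T = UNIV" "openin T = arbitrary union_of wf_base"
    using assms unfolding admits_wf_topology_def by blast
  then have "wf_topology = T"
    by (metis wf_topology_def openin_inverse)
  with T show "openin (wf_topology :: 'a topology) = arbitrary union_of wf_base"
    and "topspace (wf_topology :: 'a topology) = UNIV" by simp_all
qed

definition moderately_meet_continuous :: "'a::order itself \<Rightarrow> bool" where
  "moderately_meet_continuous _ \<longleftrightarrow>
    admits_wf_topology TYPE('a) \<and>
    (\<forall>(x::'a) D s. directed D \<and> isLub UNIV D s \<and> x \<le> s \<longrightarrow>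
      x \<in> wf_topology closure_of (down D \<inter> {..x}))"

definition scott_open :: "'a::order set \<Rightarrow> bool" where
  "scott_open U \<longleftrightarrow> U = up U \<and>
    (\<forall>D s. directed D \<and> isLub UNIV D s \<and> s \<in> U \<longrightarrow> D \<inter> U \<noteq> {})"

definition scott_topology :: "'a::order topology" where
  "scott_topology = topology scott_open"

lemma eq_up_iff: "U = up U \<longleftrightarrow> (\<forall>a\<in>U. \<forall>b. a \<le> b \<longrightarrow> b \<in> U)"
  by (auto simp: up_def set_eq_iff)

lemma scott_openD:
  assumes "scott_open U" "directed D" "isLub UNIV D s" "s \<in> U"
  shows "D \<inter> U \<noteq> {}"
  using assms unfolding scott_open_def by metis

lemma istopology_scott_open: "istopology (scott_open :: 'a::order set \<Rightarrow> bool)"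
  unfolding istopology_def
proof (intro conjI allI impI)
  fix S T :: "'a set"
  assume S: "scott_open S" and T: "scott_open T"
  have upper: "\<forall>a\<in>S. \<forall>b. a \<le> b \<longrightarrow> b \<in> S" "\<forall>a\<in>T. \<forall>b. a \<le> b \<longrightarrow> b \<in> T"
    using S T unfolding scott_open_def eq_up_iff by simp_all
  have "D \<inter> (S \<inter> T) \<noteq> {}"
    if D: "directed D" "isLub UNIV D s" "s \<in> S \<inter> T" for D s
  proof -
    have "D \<inter> S \<noteq> {}" "D \<inter> T \<noteq> {}"
      using scott_openD[OF S D(1,2)] scott_openD[OF T D(1,2)] D(3) by simp_all
    then obtain a b where ab: "a \<in> D" "a \<in> S" "b \<in> D" "b \<in> T"
      by auto
    then obtain c where "c \<in> D" "a \<le> c" "b \<le> c"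
      using D(1) unfolding directed_def by meson
    with ab upper show ?thesis
      by auto
  qed
  with upper show "scott_open (S \<inter> T)"
    unfolding scott_open_def eq_up_iff by auto
next
  fix K :: "'a set set"
  assume K: "\<forall>U\<in>K. scott_open U"
  have "D \<inter> \<Union>K \<noteq> {}"
    if D: "directed D" "isLub UNIV D s" "s \<in> \<Union>K" for D s
  proof -
    obtain U where U: "U \<in> K" "s \<in> U"
      using D(3) by auto
    with K D have "D \<inter> U \<noteq> {}"
      by (intro scott_openD) simp_all
    with U(1) show ?thesis
      by auto
  qed
  moreover have "\<forall>a\<in>\<Union>K. \<forall>b. a \<le> b \<longrightarrow> b \<in> \<Union>K"
    using K unfolding scott_open_def eq_up_iff by (meson Union_iff)
  ultimately show "scott_open (\<Union>K)"
    unfolding scott_open_def eq_up_iff by metis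
qed

lemma openin_scott_topology: "openin scott_topology = scott_open"
  unfolding scott_topology_def by (rule topology_inverse'[OF istopology_scott_open])

lemma topspace_scott_topology: "topspace (scott_topology :: 'a::order topology) = UNIV"
proof -
  have "scott_open (UNIV :: 'a set)"
    by (auto simp: scott_open_def up_def directed_def)
  then show ?thesis
    by (metis openin_scott_topology openin_subset top.extremum_uniqueI)
qed

definition meet_continuous :: "'a::order itself \<Rightarrow> bool" where
  "meet_continuous _ \<longleftrightarrow>
    (\<forall>(x::'a) D s. directed D \<and> isLub UNIV D s \<and> x \<le> s \<longrightarrow>
      x \<in> scott_topology closure_of (down D \<inter> {..x}))"

end

theory Submission
  imports Defs
begin

text \<open>The key point is that every finite \<open>F \<lless>\<^sub>W x\<close> has a member \<open>f \<lless>\<^sub>w x\<close>. Otherwise each \<open>f \<in> F\<close> has a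
  directed set \<open>D\<^sub>f\<close> with supremum \<open>x\<close> that misses \<open>{f..}\<close>. Moderate meet continuity, applied to one
  \<open>D\<^sub>f\<close> after the other, moves \<open>x\<close> down inside the wf neighbourhood \<open>wf_basic F\<close> to a point below an
  element of every \<open>D\<^sub>f\<close>, hence above no \<open>f \<in> F\<close>, although \<open>wf_basic F \<subseteq> up F\<close>. Exactness then follows from
  quasiexactness, and exactness makes every Scott open set open in the wf topology, so that wf
  closures are contained in Scott closures.\<close>

lemma isLub_UNIV_iff: "isLub UNIV D s \<longleftrightarrow> (\<forall>d\<in>D. d \<le> s) \<and> (\<forall>u. (\<forall>d\<in>D. d \<le> u) \<longrightarrow> s \<le> u)"
  by (auto simp: isLub_def leastP_def isUb_def setle_def setge_def)

lemma up_singleton: "up {y} = {y..}"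
  by (auto simp: up_def)

lemma set_weak_way_below_singleton: "{y} \<lless>\<^sub>W x \<longleftrightarrow> y \<lless>\<^sub>w x"
  by (simp add: set_weak_way_below_def weak_way_below_def up_singleton)

text \<open>The singleton of \<open>a\<close> is itself directed with supremum \<open>a\<close>, so
  it has to meet \<open>up F\<close>.\<close>

lemma wf_basic_subset_up: "wf_basic F \<subseteq> up F"
proof
  fix a assume "a \<in> wf_basic F"
  moreover have "directed {a}" "isLub UNIV {a} a"
    by (auto simp: directed_def isLub_UNIV_iff)
  ultimately show "a \<in> up F"
    unfolding wf_basic_def set_weak_way_below_def by blast
qed

lemma weak_way_below_imp_le: "y \<lless>\<^sub>w x \<Longrightarrow> y \<le> x"
  using wf_basic_subset_up[of "{y}"]
  by (auto simp: wf_basic_def set_weak_way_below_singleton up_singleton)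

lemma openin_wf_basic:
  assumes "admits_wf_topology TYPE('a::order)" "finite (F :: 'a set)"
  shows "openin wf_topology (wf_basic F)"
  unfolding openin_wf_topology[OF assms(1)]
  using assms(2) by (intro arbitrary_union_of_inc) (auto simp: wf_base_def)

lemma moderately_meet_continuousD:
  assumes "moderately_meet_continuous TYPE('a::order)"
    and "directed D" "isLub UNIV D s" "(x :: 'a) \<le> s"
  shows "x \<in> wf_topology closure_of (down D \<inter> {..x})"
proof -
  have "\<forall>(x::'a) D s. directed D \<and> isLub UNIV D s \<and> x \<le> s \<longrightarrow>
      x \<in> wf_topology closure_of (down D \<inter> {..x})"
    using assms(1) unfolding moderately_meet_continuous_def by (rule conjunct2)
  then show ?thesis
    using assms(2-4) by (elim allE[of _ x] allE[of _ D] allE[of _ s] impE) simp_all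
qed

text \<open>Induction on \<open>G\<close> with \<open>U\<close> fixed: a point already found is only
  ever moved down within \<open>U\<close>, and moving down preserves the elements avoided so
  far.\<close>

lemma ex_avoiding_in_wf_open:
  fixes x :: "'a::order"
  assumes mmc: "moderately_meet_continuous TYPE('a)"
    and U: "openin wf_topology U" "x \<in> U"
    and G: "finite G" "\<forall>g\<in>G. \<not> g \<lless>\<^sub>w x"
  shows "\<exists>y\<in>U. y \<le> x \<and> (\<forall>g\<in>G. \<not> g \<le> y)"
  using G
proof (induction G rule: finite_induct)
  case empty
  then show ?case using U(2) by blast
next
  case (insert g G)
  then obtain y where y: "y \<in> U" "y \<le> x" "\<forall>h\<in>G. \<not> h \<le> y"
    by auto
  obtain D where D: "directed D" "isLub UNIV D x" "D \<inter> {g..} = {}"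
    using insert.prems unfolding weak_way_below_def by auto
  \<comment> \<open>Meet continuity is applied at the current point \<open>y\<close>, not at
    \<open>x\<close>; this is allowed since \<open>y\<close> lies below \<open>x\<close>, the
    supremum of \<open>D\<close>.\<close>
  have "y \<in> wf_topology closure_of (down D \<inter> {..y})"
    using mmc D(1,2) y(2) by (rule moderately_meet_continuousD)
  then have "\<exists>z\<in>down D \<inter> {..y}. z \<in> U"
    using U(1) y(1) unfolding in_closure_of by blast
  then obtain z where z: "z \<in> U" "z \<in> down D" "z \<le> y"
    by auto
  \<comment> \<open>\<open>z\<close> lies below a member of \<open>D\<close>, and no member of
    \<open>D\<close> is above \<open>g\<close>.\<close>
  then have "\<not> g \<le> z"
    using D(3) order_trans[of g z] unfolding down_def by blast
  moreover have "z \<le> x" "\<forall>h\<in>G. \<not> h \<le> z"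
    using y z(3) order_trans by blast+
  ultimately show ?case
    using z(1) by blast
qed

lemma ex_weak_way_below_of_fin_w:
  fixes x :: "'a::order"
  assumes mmc: "moderately_meet_continuous TYPE('a)" and F: "F \<in> fin_w x"
  shows "\<exists>f\<in>F. f \<lless>\<^sub>w x"
proof (rule ccontr)
  assume none: "\<not> (\<exists>f\<in>F. f \<lless>\<^sub>w x)"
  have "finite F" "x \<in> wf_basic F"
    using F by (auto simp: fin_w_def wf_basic_def)
  moreover have "openin wf_topology (wf_basic F)"
    using mmc \<open>finite F\<close> by (auto simp: moderately_meet_continuous_def intro: openin_wf_basic)
  ultimately obtain y where "y \<in> wf_basic F" "\<forall>f\<in>F. \<not> f \<le> y"
    using ex_avoiding_in_wf_open[OF mmc, of "wf_basic F" x F] none by blast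
  then show False
    using wf_basic_subset_up[of F] by (auto simp: up_def)
qed

lemma exact_if_moderately_meet_continuous_quasiexact:
  assumes mmc: "moderately_meet_continuous TYPE('a::order)"
    and qe: "quasiexact_poset TYPE('a)"
  shows "exact_poset TYPE('a)"
  unfolding exact_poset_def
proof (intro allI conjI)
  fix x :: 'a
  have fam: "directed_family (fin_w x)" and inter: "(\<Inter>F\<in>fin_w x. up F) = {x..}"
    using qe unfolding quasiexact_poset_def by blast+
  note ex = ex_weak_way_below_of_fin_w[OF mmc, of _ x]
  show "directed {y. y \<lless>\<^sub>w x}"
    unfolding directed_def
  proof (intro conjI ballI)
    show "{y. y \<lless>\<^sub>w x} \<noteq> {}"
      using fam ex unfolding directed_family_def by blast
  next
    fix a b assume "a \<in> {y. y \<lless>\<^sub>w x}" "b \<in> {y. y \<lless>\<^sub>w x}"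
    then have "{a} \<in> fin_w x" "{b} \<in> fin_w x"
      by (auto simp: fin_w_def set_weak_way_below_singleton)
    then obtain F where "F \<in> fin_w x" "F \<subseteq> {a..} \<inter> {b..}"
      using fam unfolding directed_family_def up_singleton[symmetric] by meson
    \<comment> \<open>Any member of \<open>F\<close> bounds both \<open>a\<close> and
      \<open>b\<close>; \<open>ex\<close> picks one that is weakly way below
      \<open>x\<close>.\<close>
    then show "\<exists>c\<in>{y. y \<lless>\<^sub>w x}. a \<le> c \<and> b \<le> c"
      using ex by fastforce
  qed
  have "x \<le> u" if u: "\<forall>y. y \<lless>\<^sub>w x \<longrightarrow> y \<le> u" for u
  proof -
    \<comment> \<open>The member of \<open>F\<close> weakly way below \<open>x\<close> is also below
      \<open>u\<close>; the intersection of all these \<open>up F\<close> is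
      \<open>{x..}\<close>.\<close>
    have "u \<in> up F" if "F \<in> fin_w x" for F
      using ex[OF that] u unfolding up_def by blast
    then have "u \<in> {x..}"
      using inter by blast
    then show ?thesis
      by simp
  qed
  then show "isLub UNIV {y. y \<lless>\<^sub>w x} x"
    by (auto simp: isLub_UNIV_iff intro: weak_way_below_imp_le)
qed

text \<open>By exactness \<open>x\<close> is the supremum of the directed set of points weakly way
  below it, so \<open>U\<close> contains such a point \<open>y\<close>, and then all of
  \<open>{y..}\<close>.\<close>

lemma ex_wf_basic_subset_scott_open:
  fixes x :: "'a::order"
  assumes ex: "exact_poset TYPE('a)" and U: "scott_open U" "x \<in> U"
  shows "\<exists>y. x \<in> wf_basic {y} \<and> wf_basic {y} \<subseteq> U"
proof -
  have "directed {y. y \<lless>\<^sub>w x}" "isLub UNIV {y. y \<lless>\<^sub>w x} x"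
    using ex unfolding exact_poset_def by blast+
  then obtain y where y: "y \<lless>\<^sub>w x" "y \<in> U"
    using scott_openD[OF U(1) _ _ U(2)] by blast
  have "{y..} \<subseteq> U"
    using U(1) y(2) unfolding scott_open_def eq_up_iff by auto
  then have "wf_basic {y} \<subseteq> U"
    using wf_basic_subset_up[of "{y}"] by (simp add: up_singleton)
  moreover have "x \<in> wf_basic {y}"
    using y(1) by (simp add: wf_basic_def set_weak_way_below_singleton)
  ultimately show ?thesis
    by blast
qed

text \<open>Under exactness the wf topology refines the Scott topology, and a finer topology has
  smaller closures.\<close>

lemma wf_closure_subset_scott_closure:
  fixes A :: "'a::order set"
  assumes adm: "admits_wf_topology TYPE('a)" and ex: "exact_poset TYPE('a)"
  shows "wf_topology closure_of A \<subseteq> scott_topology closure_of A"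
proof
  fix x assume x: "x \<in> wf_topology closure_of A"
  have "\<exists>a\<in>A. a \<in> U" if U: "x \<in> U" "scott_open U" for U
  proof -
    obtain y where y: "x \<in> wf_basic {y}" "wf_basic {y} \<subseteq> U"
      using ex_wf_basic_subset_scott_open[OF ex U(2,1)] by blast
    have "openin wf_topology (wf_basic {y})"
      by (rule openin_wf_basic[OF adm]) simp
    with x y show ?thesis
      unfolding in_closure_of by blast
  qed
  then show "x \<in> scott_topology closure_of A"
    by (auto simp: in_closure_of topspace_scott_topology openin_scott_topology)
qed

theorem theorem4p12:
  assumes "moderately_meet_continuous TYPE('a::order)"
    and "quasiexact_poset TYPE('a)"
  shows "exact_poset TYPE('a) \<and> meet_continuous TYPE('a)"
proof
  show ex: "exact_poset TYPE('a)"
    using assms by (rule exact_if_moderately_meet_continuous_quasiexact)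
  have adm: "admits_wf_topology TYPE('a)"
    using assms(1) unfolding moderately_meet_continuous_def by blast
  show "meet_continuous TYPE('a)"
    unfolding meet_continuous_def
  proof (intro allI impI, elim conjE)
    fix x s :: 'a and D
    assume "directed D" "isLub UNIV D s" "x \<le> s"
    with assms(1) have "x \<in> wf_topology closure_of (down D \<inter> {..x})"
      by (rule moderately_meet_continuousD)
    with wf_closure_subset_scott_closure[OF adm ex]
    show "x \<in> scott_topology closure_of (down D \<inter> {..x})"
      by (rule subsetD)
  qed
qed

end
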